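(* Let $B$ be a front, let $C$ be the set of proper initial segments of elements of $B$, let $D=B\cup C$, and let $\vec{\mathcal{U}}=(\mathcal{U}_c:c\in C)$ be a sequence of p-points. Let $\mathfrak{T}$ denote the collection of all $\vec{\mathcal{U}}$-trees, partially ordered by $\supseteq$, and let $\mathcal{V}$ be an ultrafilter on $\omega$. If $f:\mathfrak{T}\to\mathcal{V}$ is a monotone cofinal map, then there is a $\vec{\mathcal{U}}$-tree $\tilde T$ such that the restriction of $f$ to $\mathfrak{T}\restriction\tilde T=\{T\in\mathfrak{T}:T\subseteq\tilde T\}$ is basic, in the topological space $2^D$.
   Context: $\mathbb{N}=\omega$; for finite $a,X\subseteq\mathbb{N}$, $a\sqsubseteq X$ means $a$ is an initial segment of $X$ in increasing enumeration. A front is a family $B$ of finite subsets of $\mathbb{N}$ such that $a\not\sqsubseteq b$ for distinct $a,b\in B$, $\bigcup B$ is infinite, and every infinite $X\subseteq\bigcup B$ has some $b\in B$ with $b\sqsubseteq X$. A p-point is a nonprincipal ultrafilter $\mathcal{W}$ on $\omega$ such that every decreasing sequence $A_0\supseteq A_1\supseteq\cdots$ in $\mathcal{W}$ has some $A\in\mathcal{W}$ with $A\setminus A_n$ finite for all $n$. A $\vec{\mathcal{U}}$-tree is a nonempty $T\subseteq D$ closed under initial segments such that $\{n\in\omega:c\cup\{n\}\in T\}\in\mathcal{U}_c$ for every $c\in T\cap C$. A map $f$ is monotone if $T\supseteq T'$ implies $f(T)\supseteq f(T')$; $f$ is cofinal if it maps every cofinal subset of $(\mathfrak{T},\supseteq)$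 to a cofinal subset of $(\mathcal{V},\supseteq)$. Linearly order finite subsets of $\mathbb{N}$ by $\prec$: for $a\ne b$ enumerated increasingly $a=\{a_1,\dots,a_m\}$, $b=\{b_1,\dots,b_n\}$, $a\prec b$ iff $a=\emptyset$, or $\max a<\max b$, or $\max a=\max b$ and $a_i<b_i$ for the least $i$ with $a_i\ne b_i$. Then $(D,\prec)$ has order type $\omega$; enumerate it as $(d_i)_{i<\omega}$ and identify $2^D$ (subsets of $D$) with $2^\omega$ (and $\mathcal{P}(\omega)$) via $d_i\mapsto i$, with the Cantor topology. Under this identification, "basic" means: for $s\in 2^m$ let $d(s)=s^{-1}(\{1\})$; a monotone map $f$ on a family $\mathcal{D}$ of subsets is basic if there are a strictly increasing $(k_m)_{m<\omega}$ and, with $E=\bigcup_m\{s\in 2^{k_m}:\exists X\in\mathcal{D}\,(d(s)=X\cap k_m)\}$, a map $\hat f:E\to 2^{<\omega}$ which is monotone ($d(s)\subseteq d(t)\Rightarrow d(\hat f(s))\subseteq d(\hat f(t))$), level preserving ($\hat f(s)\in 2^m$ for $s\in E\cap 2^{k_m}$) and initial segment preserving ($s\sqsubseteq s'$ implies $\hat f(s)\sqsubseteq \hat f(s')$), such that $f(X)=\bigcup\{d(\hat f(s)):s\in E\cap 2^{k_m}\text{ for some }m,\ d(s)=X\cap k_m\}$ for all $X\in\mathcal{D}$.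
   Formalization: In "basic", monotonicity of f̂ (d(s)⊆d(t) ⇒ d(f̂(s))⊆d(f̂(t))) is required only when s is not longer than t; without this the claim fails, e.g. for B={{n}:n∈ω}, f(T)={n+6:{n}∈T}, since a string and its extension by zeros have the same d-set. *)

theory Defs
  imports Main "HOL-Library.Sublist" "HOL-Library.Infinite_Set"
begin

definition init_seg :: "nat set \<Rightarrow> nat set \<Rightarrow> bool"  (infix "\<sqsubseteq>" 50) where
  "a \<sqsubseteq> X \<longleftrightarrow> finite a \<and> a \<subseteq> X \<and> (\<forall>x\<in>X. \<forall>y\<in>a. x \<le> y \<longrightarrow> x \<in> a)"

definition front :: "nat set set \<Rightarrow> bool" where
  "front B \<longleftrightarrow>
     (\<forall>b\<in>B. finite b) \<and>
     (\<forall>a\<in>B. \<forall>b\<in>B. a \<noteq> b \<longrightarrow> \<not> a \<sqsubseteq> b) \<and>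
     infinite (\<Union>B) \<and>
     (\<forall>X. X \<subseteq> \<Union>B \<and> infinite X \<longrightarrow> (\<exists>b\<in>B. b \<sqsubseteq> X))"

definition front_C :: "nat set set \<Rightarrow> nat set set" where
  "front_C B = {c. \<exists>b\<in>B. c \<sqsubseteq> b \<and> c \<noteq> b}"

definition front_D :: "nat set set \<Rightarrow> nat set set" where
  "front_D B = B \<union> front_C B"

definition ultrafilter :: "nat set set \<Rightarrow> bool" where
  "ultrafilter W \<longleftrightarrow>
     UNIV \<in> W \<and> {} \<notin> W \<and>
     (\<forall>X\<in>W. \<forall>Y\<in>W. X \<inter> Y \<in> W) \<and>
     (\<forall>X\<in>W. \<forall>Y. X \<subseteq> Y \<longrightarrow> Y \<in> W) \<and>
     (\<forall>X. X \<in> W \<or> - X \<in> W)"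

definition p_point :: "nat set set \<Rightarrow> bool" where
  "p_point W \<longleftrightarrow>
     ultrafilter W \<and> (\<forall>n. {n} \<notin> W) \<and>
     (\<forall>A :: nat \<Rightarrow> nat set. (\<forall>n. A n \<in> W) \<and> (\<forall>n. A (Suc n) \<subseteq> A n) \<longrightarrow>
        (\<exists>X\<in>W. \<forall>n. finite (X - A n)))"

text \<open>Only the values of \<open>U\<close> on \<open>front_C B\<close> matter.\<close>

definition U_trees :: "nat set set \<Rightarrow> (nat set \<Rightarrow> nat set set) \<Rightarrow> nat set set set" where
  "U_trees B U = {T. T \<noteq> {} \<and> T \<subseteq> front_D B \<and>
     (\<forall>t\<in>T. \<forall>s. s \<sqsubseteq> t \<longrightarrow> s \<in> T) \<and>
     (\<forall>c \<in> T \<inter> front_C B. {n. c \<union> {n} \<in> T} \<in> U c)}"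

definition cofinal_in :: "'a set set \<Rightarrow> 'a set set \<Rightarrow> bool" where
  "cofinal_in S P \<longleftrightarrow> S \<subseteq> P \<and> (\<forall>p\<in>P. \<exists>s\<in>S. p \<supseteq> s)"

definition cofinal_map :: "('a set \<Rightarrow> 'b set) \<Rightarrow> 'a set set \<Rightarrow> 'b set set \<Rightarrow> bool" where
  "cofinal_map f P Q \<longleftrightarrow> (\<forall>S. cofinal_in S P \<longrightarrow> cofinal_in (f ` S) Q)"

definition prec :: "nat set \<Rightarrow> nat set \<Rightarrow> bool"  (infix "\<prec>" 50) where
  "a \<prec> b \<longleftrightarrow> a \<noteq> b \<and>
     (a = {} \<or>
      b \<noteq> {} \<and>
      (Max a < Max b \<or>
       Max a = Max b \<and>
       (let xs = sorted_list_of_set a; ys = sorted_list_of_set b in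
        \<exists>i < min (length xs) (length ys). (\<forall>j<i. xs ! j = ys ! j) \<and> xs ! i < ys ! i)))"

text \<open>The increasing enumeration of \<open>D\<close> in order type \<open>\<omega>\<close>; see \<open>prec_enum_front\<close> below for its
  existence and uniqueness.\<close>

definition prec_enum :: "nat set set \<Rightarrow> nat \<Rightarrow> nat set" where
  "prec_enum D = (THE d. bij_betw d UNIV D \<and> (\<forall>i j. i < j \<longrightarrow> d i \<prec> d j))"

text \<open>Finite 0-1 sequences are represented by boolean lists.\<close>

definition dset :: "bool list \<Rightarrow> nat set" where
  "dset s = {i. i < length s \<and> s ! i}"

definition restr_level :: "nat set set \<Rightarrow> nat \<Rightarrow> bool list set" where
  "restr_level \<D> n = {s. length s = n \<and> (\<exists>X\<in>\<D>. dset s = X \<inter> {..<n})}"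

text \<open>In the monotonicity clause for \<open>g\<close>, inclusion is compared only when \<open>s\<close> is not longer than
  \<open>t\<close>. Without the length restriction level preservation would rule out even the shift
  \<open>X \<mapsto> {x + 1 | x \<in> X}\<close>: a string and its extension by zeros have the same \<open>dset\<close>, so \<open>g\<close> could
  never add a point above the current level.\<close>

definition basic_map :: "(nat set \<Rightarrow> nat set) \<Rightarrow> nat set set \<Rightarrow> bool" where
  "basic_map f \<D> \<longleftrightarrow>
     monotone_on \<D> (\<supseteq>) (\<supseteq>) f \<and>
     (\<exists>(k :: nat \<Rightarrow> nat) (g :: bool list \<Rightarrow> bool list).
        strict_mono k \<and>
        (let E = (\<Union>m. restr_level \<D> (k m)) in
          (\<forall>s\<in>E. \<forall>t\<in>E. length s \<le> length t \<and> dset s \<subseteq> dset t \<longrightarrow> dset (g s) \<subseteq> dset (g t)) \<and>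
          (\<forall>m. \<forall>s\<in>E. length s = k m \<longrightarrow> length (g s) = m) \<and>
          (\<forall>s\<in>E. \<forall>s'\<in>E. prefix s s' \<longrightarrow> prefix (g s) (g s')) \<and>
          (\<forall>X\<in>\<D>. f X = \<Union>{dset (g s) | s m. s \<in> E \<and> length s = k m \<and> dset s = X \<inter> {..<k m}})))"

text \<open>Transport of a map on a family \<open>\<TT>\<close> of subsets of \<open>D\<close> along the identification of
  \<open>d i\<close> with \<open>i\<close>.\<close>

definition basic_on :: "nat set set \<Rightarrow> (nat set set \<Rightarrow> nat set) \<Rightarrow> nat set set set \<Rightarrow> bool" where
  "basic_on D f \<TT> \<longleftrightarrow>
     basic_map (\<lambda>X. f (prec_enum D ` X)) ((\<lambda>T. prec_enum D -` T) ` \<TT>)"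

definition prec_key :: "nat set \<Rightarrow> nat list" where
  "prec_key a = (if a = {} then [] else Max a # sorted_list_of_set a)"

lemma Max_sorted_list_of_set:
  assumes "finite a" "a \<noteq> {}"
  shows "Max a = sorted_list_of_set a ! (length (sorted_list_of_set a) - 1)"
proof (rule Max_eqI)
  let ?xs = "sorted_list_of_set a"
  have ne: "?xs \<noteq> []" using assms by simp
  then show "?xs ! (length ?xs - 1) \<in> a"
    using assms nth_mem[of "length ?xs - 1" ?xs] by (simp add: card_gt_0_iff)
  show "y \<le> ?xs ! (length ?xs - 1)" if y: "y \<in> a" for y
  proof -
    have "y \<in> set ?xs" using y assms by simp
    then obtain i where i: "i < length ?xs" "?xs ! i = y" by (auto simp only: in_set_conv_nth)
    have "?xs ! i \<le> ?xs ! (length ?xs - 1)"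
      by (rule sorted_nth_mono) (use i in \<open>simp_all del: length_sorted_list_of_set\<close>)
    then show ?thesis using i(2) by simp
  qed
qed (use assms in simp)

lemma prec_key_less_iff:
  assumes "finite a" "finite b"
  shows "a \<prec> b \<longleftrightarrow> (prec_key a, prec_key b) \<in> lexord less_than"
proof (cases "a = {} \<or> b = {}")
  case True
  then show ?thesis by (auto simp: prec_def prec_key_def neq_Nil_conv)
next
  case False
  define xs where "xs = sorted_list_of_set a"
  define ys where "ys = sorted_list_of_set b"
  have ne: "xs \<noteq> []" "ys \<noteq> []" using False assms by (auto simp: xs_def ys_def)
  have mx: "Max a = xs ! (length xs - 1)"
    unfolding xs_def using assms False by (intro Max_sorted_list_of_set) auto
  have my: "Max b = ys ! (length ys - 1)"
    unfolding ys_def using assms False by (intro Max_sorted_list_of_set) auto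
  have nopre: "\<not> (length xs < length ys \<and> take (length xs) ys = xs)" if "Max a = Max b"
  proof
    assume h: "length xs < length ys \<and> take (length xs) ys = xs"
    have "xs ! (length xs - 1) = take (length xs) ys ! (length xs - 1)" using h by simp
    also have "\<dots> = ys ! (length xs - 1)" using ne by simp
    also have "\<dots> < ys ! (length ys - 1)"
    proof -
      have "length xs - 1 < length ys - 1" "length ys - 1 < length ys"
        using h ne by (simp_all add: diff_less_mono Suc_le_eq)
      moreover have "sorted_wrt (<) ys" unfolding ys_def by (rule strict_sorted_list_of_set)
      ultimately show ?thesis by (auto intro: sorted_wrt_nth_less)
    qed
    finally show False using that mx my by simp
  qed
  have tk: "take i xs = take i ys \<longleftrightarrow> (\<forall>j<i. xs ! j = ys ! j)" if "i < min (length xs) (length ys)" for i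
    using that by (auto simp: list_eq_iff_nth_eq)
  have "a \<noteq> b" if "i < min (length xs) (length ys)" "xs ! i < ys ! i" for i
    using that unfolding xs_def ys_def by auto
  then have "a \<prec> b \<longleftrightarrow> Max a < Max b \<or> Max a = Max b \<and> (xs, ys) \<in> lexord less_than"
    using False nopre tk
    unfolding prec_def lexord_take_index_conv Let_def xs_def[symmetric] ys_def[symmetric] by auto
  then show ?thesis using False by (simp add: prec_key_def xs_def ys_def)
qed

lemma prec_key_inj: "finite a \<Longrightarrow> finite b \<Longrightarrow> prec_key a = prec_key b \<Longrightarrow> a = b"
  by (auto simp: prec_key_def sorted_list_of_set_inject split: if_splits)

lemma prec_irrefl: "\<not> a \<prec> a"
  by (simp add: prec_def)

lemma prec_trans:
  assumes "finite a" "finite b" "finite c" "a \<prec> b" "b \<prec> c"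
  shows "a \<prec> c"
  using lexord_trans[of "prec_key a" "prec_key b" less_than "prec_key c"] assms trans_less_than
  by (simp only: prec_key_less_iff)

lemma prec_total:
  assumes "finite a" "finite b" "a \<noteq> b"
  shows "a \<prec> b \<or> b \<prec> a"
proof -
  have "\<forall>x y :: nat. (x, y) \<in> less_than \<or> x = y \<or> (y, x) \<in> less_than" by auto
  from lexord_linear[OF this, of "prec_key a" "prec_key b"] show ?thesis
    using assms prec_key_inj[of a b] by (simp only: prec_key_less_iff) blast
qed

lemma finite_prec_below:
  assumes "\<And>a. a \<in> D \<Longrightarrow> finite a"
  shows "finite {x \<in> D. x \<prec> a}"
proof (rule finite_subset)
  show "{x \<in> D. x \<prec> a} \<subseteq> Pow {..Max a}"
  proof (intro subsetI PowI)
    fix x y assume x: "x \<in> {x \<in> D. x \<prec> a}" and y: "y \<in> x"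
    then have "y \<le> Max x" using assms by simp
    also have "Max x \<le> Max a" using x y by (auto simp: prec_def)
    finally show "y \<in> {..Max a}" by simp
  qed
qed simp

lemma prec_enum_ex1:
  assumes fin: "\<And>a. a \<in> D \<Longrightarrow> finite a" and inf: "infinite D"
  shows "\<exists>!d. bij_betw d (UNIV :: nat set) D \<and> (\<forall>i j. i < j \<longrightarrow> d i \<prec> d j)"
proof -
  define g where "g a = card {x \<in> D. x \<prec> a}" for a
  have g_less: "g a < g b" if "a \<in> D" "b \<in> D" "a \<prec> b" for a b
    unfolding g_def
  proof (rule psubset_card_mono)
    show "finite {x \<in> D. x \<prec> b}" by (rule finite_prec_below[OF fin])
    show "{x \<in> D. x \<prec> a} \<subset> {x \<in> D. x \<prec> b}"
    proof
      show "{x \<in> D. x \<prec> a} \<subseteq> {x \<in> D. x \<prec> b}"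
      proof
        fix x assume "x \<in> {x \<in> D. x \<prec> a}"
        then show "x \<in> {x \<in> D. x \<prec> b}"
          using that prec_trans[of x a b] fin by simp
      qed
      have "a \<in> {x \<in> D. x \<prec> b}" "a \<notin> {x \<in> D. x \<prec> a}" using that prec_irrefl by auto
      then show "{x \<in> D. x \<prec> a} \<noteq> {x \<in> D. x \<prec> b}" by blast
    qed
  qed
  have g_inj: "inj_on g D"
    by (rule inj_onI) (metis fin g_less less_irrefl prec_total)
  have down: "\<exists>b\<in>D. g b = n" if "a \<in> D" "n < g a" for a n
  proof -
    have sub: "g ` {x \<in> D. x \<prec> a} \<subseteq> {..<g a}" using g_less that by auto
    have "card (g ` {x \<in> D. x \<prec> a}) = g a"
      unfolding g_def[of a] by (rule card_image) (rule inj_on_subset[OF g_inj], auto)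
    then have "g ` {x \<in> D. x \<prec> a} = {..<g a}"
      using sub by (intro card_subset_eq) auto
    then show ?thesis using that by (metis (no_types, lifting) imageE lessThan_iff mem_Collect_eq)
  qed
  have g_bij: "bij_betw g D UNIV"
    unfolding bij_betw_def
  proof (intro conjI g_inj equalityI subset_UNIV subsetI)
    fix n :: nat
    have "infinite (g ` D)" using inf g_inj by (simp add: finite_image_iff)
    then obtain a where "a \<in> D" "n < g a"
      by (auto simp: infinite_nat_iff_unbounded)
    then show "n \<in> g ` D" using down by blast
  qed
  have g_less_iff: "a \<prec> b" if "a \<in> D" "b \<in> D" "g a < g b" for a b
    using that g_less fin prec_total by (metis less_asym)
  show ?thesis
  proof (rule ex1I[of _ "inv_into D g"])
    have "inv_into D g i \<prec> inv_into D g j" if "i < j" for i j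
      using g_less_iff[of "inv_into D g i" "inv_into D g j"] g_bij that
      by (metis UNIV_I bij_betw_def f_inv_into_f inv_into_into)
    then show "bij_betw (inv_into D g) UNIV D \<and> (\<forall>i j. i < j \<longrightarrow> inv_into D g i \<prec> inv_into D g j)"
      using bij_betw_inv_into[OF g_bij] by blast
  next
    fix d :: "nat \<Rightarrow> nat set"
    assume d: "bij_betw d UNIV D \<and> (\<forall>i j. i < j \<longrightarrow> d i \<prec> d j)"
    then have dD: "d i \<in> D" for i by (meson UNIV_I bij_betwE)
    have asym: "\<not> d j \<prec> d i" if "i \<le> j" for i j
    proof (cases "i = j")
      case False
      then have "d i \<prec> d j" using d that by simp
      then show ?thesis
        using prec_trans[of "d i" "d j" "d i"] prec_irrefl[of "d i"] fin[OF dD] by blast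
    qed (simp add: prec_irrefl)
    have "g (d i) = i" for i
    proof -
      have "{x \<in> D. x \<prec> d i} = d ` {..<i}"
      proof
        show "{x \<in> D. x \<prec> d i} \<subseteq> d ` {..<i}"
        proof
          fix x assume "x \<in> {x \<in> D. x \<prec> d i}"
          then obtain j where "x = d j" "d j \<prec> d i"
            using d by (auto simp: bij_betw_def)
          then show "x \<in> d ` {..<i}" using asym[of i j] by (cases "i \<le> j") auto
        qed
        show "d ` {..<i} \<subseteq> {x \<in> D. x \<prec> d i}" using d dD by auto
      qed
      moreover have "inj_on d {..<i}" using d by (meson bij_betw_def inj_on_subset subset_UNIV)
      ultimately show ?thesis unfolding g_def by (simp add: card_image)
    qed
    then show "d = inv_into D g"
      using g_inj dD by (metis ext inv_into_f_f)
  qed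
qed

lemma front_D_finite: "front B \<Longrightarrow> a \<in> front_D B \<Longrightarrow> finite a"
  by (auto simp: front_def front_D_def front_C_def init_seg_def)

lemma front_D_infinite: "front B \<Longrightarrow> infinite (front_D B)"
  using finite_Union[of B] by (auto simp: front_def front_D_def)

lemma prec_enum_front:
  assumes "front B"
  shows "bij_betw (prec_enum (front_D B)) UNIV (front_D B)"
    and "i < j \<Longrightarrow> prec_enum (front_D B) i \<prec> prec_enum (front_D B) j"
  using theI'[OF prec_enum_ex1[OF front_D_finite[OF assms] front_D_infinite[OF assms]]]
  unfolding prec_enum_def by blast+

end

theory Submission
  imports Defs "HOL-Library.Countable_Set" "HOL-Library.Nat_Bijection"
begin

text \<open>
  For a finite set \<open>s\<close> of nodes below a level \<open>p\<close>, only finitely many questions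
  \<open>m \<in> f T\<close> with \<open>m \<le> p\<close> and \<open>T \<inter> Pow {..<p} = s\<close> arise, and since \<open>f\<close> is monotone each of them
  is settled negatively, if at all, by shrinking the sets of successors \<open>\<ge> p\<close> to members
  \<open>Y p c\<close> of the ultrafilters. It remains to fuse the \<open>Y p\<close> over infinitely many levels \<open>p\<close>.
  The p-point property gives \<open>Z c \<in> U c\<close> almost contained in all \<open>Y p c\<close>, hence levels
  \<open>P 0 < P 1 < \<dots>\<close> with \<open>Z c - {..<P (i + 1)} \<subseteq> Y (P i) c\<close> whenever \<open>c\<close> is among the first \<open>P i\<close>
  nodes. If all the blocks \<open>{P i..<P (i + 1)}\<close> with \<open>i \<in> I\<close> can be deleted from every \<open>Z c\<close>, the levels
  \<open>P i\<close> with \<open>i \<in> I\<close> are as required. Such an infinite \<open>I\<close> exists, for all the countably many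
  ultrafilters at once, because there are uncountably many almost disjoint candidates and each
  ultrafilter contains the union of the blocks of at most one of them.
\<close>

section \<open>Ultrafilters and p-points\<close>

lemma ultrafilter_mono: "ultrafilter W \<Longrightarrow> X \<in> W \<Longrightarrow> X \<subseteq> Y \<Longrightarrow> Y \<in> W"
  unfolding ultrafilter_def by blast

lemma ultrafilter_Int: "ultrafilter W \<Longrightarrow> X \<in> W \<Longrightarrow> Y \<in> W \<Longrightarrow> X \<inter> Y \<in> W"
  unfolding ultrafilter_def by blast

lemma ultrafilter_UNIV: "ultrafilter W \<Longrightarrow> UNIV \<in> W"
  unfolding ultrafilter_def by blast

lemma ultrafilter_INT:
  assumes "ultrafilter W" "finite J" "\<And>j. j \<in> J \<Longrightarrow> X j \<in> W"
  shows "(\<Inter>j\<in>J. X j) \<in> W"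
  using assms(2,3)
  by (induction J rule: finite_induct) (auto intro: ultrafilter_UNIV ultrafilter_Int assms(1))

lemma p_point_ultrafilter: "p_point W \<Longrightarrow> ultrafilter W"
  unfolding p_point_def by blast

lemma p_point_cofinite:
  assumes "p_point W" "finite F"
  shows "- F \<in> W"
proof -
  have "- {n} \<in> W" for n
    using assms(1) unfolding p_point_def ultrafilter_def by blast
  then have "(\<Inter>n\<in>F. - {n}) \<in> W"
    by (intro ultrafilter_INT p_point_ultrafilter assms)
  moreover have "(\<Inter>n\<in>F. - {n}) = - F" by auto
  ultimately show ?thesis by simp
qed

lemma p_point_infinite:
  assumes "p_point W" "X \<in> W"
  shows "infinite X"
proof
  assume "finite X"
  then have "- X \<inter> X \<in> W"
    using assms p_point_cofinite p_point_ultrafilter ultrafilter_Int by blast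
  then show False using p_point_ultrafilter[OF assms(1)] by (simp add: ultrafilter_def)
qed

text \<open>Finite intersections turn an arbitrary sequence into a decreasing one, to which the
  definition applies.\<close>

lemma p_point_pseudo_intersection:
  fixes A :: "nat \<Rightarrow> nat set"
  assumes "p_point W" "\<And>n. A n \<in> W"
  shows "\<exists>X\<in>W. \<forall>n. finite (X - A n)"
proof -
  define A' where "A' n = (\<Inter>i\<in>{..n}. A i)" for n
  have "A' n \<in> W" for n
    unfolding A'_def by (intro ultrafilter_INT p_point_ultrafilter assms) auto
  moreover have "A' (Suc n) \<subseteq> A' n" for n
    by (auto simp: A'_def)
  ultimately obtain X where X: "X \<in> W" "\<And>n. finite (X - A' n)"
    using assms(1) unfolding p_point_def by blast
  have "finite (X - A n)" for n
    by (rule finite_subset[OF _ X(2)[of n]]) (auto simp: A'_def)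
  then show ?thesis using X(1) by blast
qed

text \<open>The branch of \<open>x\<close> through the binary tree, with nodes coded as numbers. The
  length \<open>n\<close> is part of the code, so that even a finite \<open>x\<close> has an
  infinite branch.\<close>

definition ad_branch :: "nat set \<Rightarrow> nat set" where
  "ad_branch x = range (\<lambda>n. prod_encode (n, set_encode (x \<inter> {..<n})))"

lemma infinite_ad_branch: "infinite (ad_branch x)"
  unfolding ad_branch_def by (rule range_inj_infinite) (auto intro!: injI)

lemma ad_branch_almost_disjoint:
  assumes "x \<noteq> y"
  shows "finite (ad_branch x \<inter> ad_branch y)"
proof -
  obtain k where k: "k \<in> x \<longleftrightarrow> k \<notin> y" using assms by blast
  have "ad_branch x \<inter> ad_branch y \<subseteq> (\<lambda>n. prod_encode (n, set_encode (x \<inter> {..<n}))) ` {..k}"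
  proof
    fix z assume "z \<in> ad_branch x \<inter> ad_branch y"
    then obtain n where n: "z = prod_encode (n, set_encode (x \<inter> {..<n}))"
      "set_encode (x \<inter> {..<n}) = set_encode (y \<inter> {..<n})"
      by (auto simp: ad_branch_def)
    then have "x \<inter> {..<n} = y \<inter> {..<n}" by (simp add: set_encode_eq)
    then have "n \<le> k" using k by (metis IntD1 IntI lessThan_iff not_le)
    then show "z \<in> (\<lambda>n. prod_encode (n, set_encode (x \<inter> {..<n}))) ` {..k}" using n by blast
  qed
  then show ?thesis by (rule finite_subset) simp
qed

text \<open>Were every branch refuted by some \<open>U j\<close>, choosing such a \<open>j\<close>
  would inject the sets of naturals into the naturals: two branches with the same \<open>j\<close>
  would put a finite set into \<open>U j\<close>.\<close>

lemma p_points_common_gaps: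
  fixes U :: "nat \<Rightarrow> nat set set" and P :: "nat \<Rightarrow> nat"
  assumes pp: "\<And>j. p_point (U j)" and P: "strict_mono P"
  shows "\<exists>I. infinite I \<and> (\<forall>j. - (\<Union>i\<in>I. {P i..<P (Suc i)}) \<in> U j)"
proof (rule ccontr)
  let ?G = "\<lambda>I. \<Union>i\<in>I. {P i..<P (Suc i)}"
  assume neg: "\<not> ?thesis"
  have "\<exists>j. ?G (ad_branch x) \<in> U j" for x
    using neg infinite_ad_branch[of x] p_point_ultrafilter[OF pp]
    unfolding ultrafilter_def by blast
  then obtain h where h: "\<And>x. ?G (ad_branch x) \<in> U (h x)" by metis
  have "inj h"
  proof (rule injI, rule ccontr)
    fix x y assume xy: "h x = h y" "x \<noteq> y"
    \<comment> \<open>The blocks are pairwise disjoint, so the unions over two branches meet only in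
      the blocks with a common index.\<close>
    have block: "i = i'" if "n \<in> {P i..<P (Suc i)}" "n \<in> {P i'..<P (Suc i')}" for i i' n
      using that strict_mono_less[OF P, of i "Suc i'"] strict_mono_less[OF P, of i' "Suc i"] by simp
    have "?G (ad_branch x) \<inter> ?G (ad_branch y) \<subseteq> ?G (ad_branch x \<inter> ad_branch y)"
      using block by blast
    moreover have "finite (?G (ad_branch x \<inter> ad_branch y))"
      using ad_branch_almost_disjoint[OF xy(2)] by simp
    ultimately have "finite (?G (ad_branch x) \<inter> ?G (ad_branch y))"
      by (rule finite_subset)
    moreover have "?G (ad_branch x) \<inter> ?G (ad_branch y) \<in> U (h x)"
      using ultrafilter_Int[OF p_point_ultrafilter[OF pp]] h[of x] h[of y] xy(1) by simp
    ultimately show False using p_point_infinite[OF pp] by blast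
  qed
  then have "range (inv h) = Pow UNIV" by (simp add: inj_imp_surj_inv)
  then show False using Cantors_theorem by blast
qed

text \<open>The point is exact inclusion from \<open>p\<close> on for every \<open>p\<close> in
  \<open>I\<close>; a pseudo-intersection alone leaves finitely many exceptions, of unknown
  size.\<close>

lemma p_points_fusion_nat:
  fixes U :: "nat \<Rightarrow> nat set set" and Y :: "nat \<Rightarrow> nat \<Rightarrow> nat set"
  assumes pp: "\<And>j. p_point (U j)" and Y: "\<And>p j. Y p j \<in> U j"
  shows "\<exists>X I. infinite I \<and> (\<forall>j. X j \<in> U j \<and> (\<forall>p\<in>I. \<forall>n\<in>X j. p \<le> n \<longrightarrow> n \<in> Y p j))"
proof -
  have "\<exists>Z\<in>U j. \<forall>p. finite (Z - Y p j)" for j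
    using p_point_pseudo_intersection[OF pp, of "\<lambda>p. Y p j" j] Y by blast
  then obtain Z where Z: "\<And>j. Z j \<in> U j" and fin: "\<And>j p. finite (Z j - Y p j)" by metis
  \<comment> \<open>One bound can serve only finitely many indices \<open>j\<close>, hence the
    restriction to those up to \<open>q\<close>.\<close>
  have "\<exists>b>q. \<forall>j\<le>q. Z j - Y q j \<subseteq> {..<b}" for q
  proof -
    have "finite (insert q (\<Union>j\<in>{..q}. Z j - Y q j))" using fin by simp
    then obtain b where "insert q (\<Union>j\<in>{..q}. Z j - Y q j) \<subseteq> {..<b}"
      using finite_nat_bounded by blast
    then show ?thesis by (intro exI[of _ b]) auto
  qed
  then obtain h where h: "\<And>q. h q > q" "\<And>q j. j \<le> q \<Longrightarrow> Z j - Y q j \<subseteq> {..<h q}" by metis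
  define P where "P i = (h ^^ i) 0" for i
  have P_Suc: "P (Suc i) = h (P i)" for i by (simp add: P_def)
  have P: "strict_mono P" by (simp add: strict_mono_Suc_iff P_Suc h)
  obtain I where I: "infinite I" and
    gap: "\<And>j. - (\<Union>i\<in>I. {P i..<P (Suc i)}) \<in> U j"
    using p_points_common_gaps[of U P] pp P by blast
  \<comment> \<open>For \<open>p = P i\<close> with \<open>j \<le> p\<close>, every exception that
    is at least \<open>p\<close> lies in the deleted block \<open>i\<close>. The finitely many
    \<open>p < j\<close>, not covered by the bound \<open>h\<close>, are met by the last
    factor.\<close>
  define X where "X j = Z j \<inter> - (\<Union>i\<in>I. {P i..<P (Suc i)}) \<inter> (\<Inter>p\<in>{..<j}. Y p j)" for j
  have XU: "X j \<in> U j" for j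
    unfolding X_def by (intro ultrafilter_Int ultrafilter_INT p_point_ultrafilter pp Z gap Y) simp
  have XY: "n \<in> Y p j" if p: "p \<in> P ` I" and "n \<in> X j" "p \<le> n" for p j n
  proof (cases "p < j")
    case True
    then show ?thesis using that(2) by (auto simp: X_def)
  next
    case False
    obtain i where i: "i \<in> I" "p = P i" using p by blast
    have "n \<notin> {P i..<P (Suc i)}" using that(2) i(1) by (auto simp: X_def)
    then have "\<not> n < h p" using that(3) i by (simp add: P_Suc)
    moreover have "n \<in> Z j" using that(2) by (simp add: X_def)
    ultimately show ?thesis using h(2)[of j p] False by auto
  qed
  have "infinite (P ` I)"
    using I strict_mono_imp_inj_on[OF P] by (metis finite_imageD inj_on_subset subset_UNIV)
  then show ?thesis
    by (intro exI[of _ X] exI[of _ "P ` I"] conjI allI ballI impI XU XY)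
qed

lemma p_points_fusion:
  fixes U :: "'a \<Rightarrow> nat set set" and Y :: "nat \<Rightarrow> 'a \<Rightarrow> nat set"
  assumes K: "countable K" and pp: "\<And>c. c \<in> K \<Longrightarrow> p_point (U c)"
    and Y: "\<And>p c. c \<in> K \<Longrightarrow> Y p c \<in> U c"
  shows "\<exists>X I. infinite I \<and> (\<forall>c\<in>K. X c \<in> U c \<and> (\<forall>p\<in>I. \<forall>n\<in>X c. p \<le> n \<longrightarrow> n \<in> Y p c))"
proof (cases "K = {}")
  case True
  then show ?thesis using infinite_UNIV_nat by blast
next
  case False
  define e where "e = from_nat_into K"
  have e: "e j \<in> K" for j unfolding e_def using False by (rule from_nat_into)
  have "\<exists>X I. infinite I \<and> (\<forall>j. X j \<in> U (e j) \<and> (\<forall>p\<in>I. \<forall>n\<in>X j. p \<le> n \<longrightarrow> n \<in> Y p (e j)))"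
    by (intro p_points_fusion_nat pp Y e)
  then obtain X I where I: "infinite I" and
    X: "\<forall>j. X j \<in> U (e j) \<and> (\<forall>p\<in>I. \<forall>n\<in>X j. p \<le> n \<longrightarrow> n \<in> Y p (e j))" by blast
  have inv: "e (to_nat_on K c) = c" if "c \<in> K" for c
    unfolding e_def using K that by (rule from_nat_into_to_nat_on)
  have "X (to_nat_on K c) \<in> U c \<and> (\<forall>p\<in>I. \<forall>n\<in>X (to_nat_on K c). p \<le> n \<longrightarrow> n \<in> Y p c)"
    if "c \<in> K" for c
    using spec[OF X, of "to_nat_on K c"] unfolding inv[OF that] .
  then show ?thesis using I by (intro exI[of _ "\<lambda>c. X (to_nat_on K c)"] exI[of _ I]) blast
qed

section \<open>Initial segments and trees\<close>

lemma init_seg_trans: "a \<sqsubseteq> b \<Longrightarrow> b \<sqsubseteq> c \<Longrightarrow> a \<sqsubseteq> c"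
  unfolding init_seg_def by blast

lemma init_seg_insert_max:
  assumes "finite c" "\<forall>x\<in>c. x < n"
  shows "c \<sqsubseteq> insert n c"
  using assms unfolding init_seg_def by force

text \<open>Under the order conditions \<open>n\<close> and \<open>n'\<close> are maxima. If they
  differ, \<open>n'\<close> lies in \<open>c\<close>, and the shorter set cannot reach up to
  \<open>n\<close>.\<close>

lemma insert_init_seg_insert_cases:
  assumes "\<forall>x\<in>c. x < n" "\<forall>x\<in>c'. x < n'" "insert n' c' \<sqsubseteq> insert n c"
  shows "n' = n \<and> c' = c \<or> insert n' c' \<sqsubseteq> c"
proof (cases "n' = n")
  case True
  have "c' = c"
  proof
    show "c' \<subseteq> c" using assms True by (auto simp: init_seg_def)
    show "c \<subseteq> c'" using assms True less_imp_le by (fastforce simp: init_seg_def)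
  qed
  then show ?thesis using True by simp
next
  case False
  then have "n' \<in> c" using assms(3) by (auto simp: init_seg_def)
  then have "n' < n" using assms(1) by blast
  then have "n \<notin> c'" using assms(2) by fastforce
  then have "insert n' c' \<subseteq> c" using assms(3) \<open>n' \<in> c\<close> by (auto simp: init_seg_def)
  then show ?thesis using assms(3) by (simp add: init_seg_def)
qed

lemma front_C_if_proper_init_seg:
  assumes "front B" "a \<in> front_D B" "c \<sqsubseteq> a" "c \<noteq> a"
  shows "c \<in> front_C B"
  using assms(2) unfolding front_D_def
proof
  assume "a \<in> front_C B"
  then obtain b where b: "b \<in> B" "a \<sqsubseteq> b" "a \<noteq> b" by (auto simp: front_C_def)
  have "c \<noteq> b" using b assms(3,4) by (auto simp: init_seg_def)
  then show ?thesis using b init_seg_trans[OF assms(3)] by (auto simp: front_C_def)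
qed (use assms in \<open>auto simp: front_C_def\<close>)

lemma countable_front_C: "countable (front_C B)"
  by (rule countable_subset[OF _ countable_Collect_finite]) (auto simp: front_C_def init_seg_def)

lemma U_trees_subset: "T \<in> U_trees B U \<Longrightarrow> T \<subseteq> front_D B"
  by (simp add: U_trees_def)

lemma U_trees_init_seg: "T \<in> U_trees B U \<Longrightarrow> t \<in> T \<Longrightarrow> s \<sqsubseteq> t \<Longrightarrow> s \<in> T"
  unfolding U_trees_def by blast

lemma U_trees_succ: "T \<in> U_trees B U \<Longrightarrow> c \<in> T \<Longrightarrow> c \<in> front_C B \<Longrightarrow> {n. insert n c \<in> T} \<in> U c"
  unfolding U_trees_def by simp

lemma U_trees_empty: "T \<in> U_trees B U \<Longrightarrow> {} \<in> T"
  by (auto simp: U_trees_def init_seg_def)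

text \<open>Each nonempty initial segment of \<open>a\<close> is read as \<open>insert n c\<close>
  with maximum \<open>n\<close>. Thus \<open>s\<close> controls the nodes inside
  \<open>{..<p}\<close>, and \<open>Y\<close> controls every step from \<open>p\<close> on.\<close>

definition prune :: "nat set set \<Rightarrow> nat set set \<Rightarrow> nat \<Rightarrow> (nat set \<Rightarrow> nat set) \<Rightarrow> nat set set" where
  "prune T s p Y = {a \<in> T. \<forall>c n. (\<forall>x\<in>c. x < n) \<and> insert n c \<sqsubseteq> a \<longrightarrow>
     (if n < p then insert n c \<in> s else n \<in> Y c)}"

lemma prune_subset: "prune T s p Y \<subseteq> T"
  by (auto simp: prune_def)

lemma prune_mono: "s \<subseteq> s' \<Longrightarrow> prune T s p Y \<subseteq> prune T s' p Y"
  unfolding prune_def by (auto split: if_splits)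

text \<open>At a surviving node \<open>c\<close>, all but finitely many successors exceed both
  \<open>p\<close> and \<open>c\<close>, so \<open>Y c\<close> is the only new demand on them;
  p-points contain the cofinite sets.\<close>

lemma prune_U_tree:
  assumes B: "front B" and pp: "\<And>c. c \<in> front_C B \<Longrightarrow> p_point (U c)"
    and T: "T \<in> U_trees B U" and Y: "\<And>c. c \<in> front_C B \<Longrightarrow> Y c \<in> U c"
  shows "prune T s p Y \<in> U_trees B U"
proof -
  have "{} \<in> prune T s p Y"
    using U_trees_empty[OF T] by (auto simp: prune_def init_seg_def)
  moreover have "prune T s p Y \<subseteq> front_D B"
    using prune_subset U_trees_subset[OF T] by blast
  moreover have "r \<in> prune T s p Y" if "t \<in> prune T s p Y" "r \<sqsubseteq> t" for r t
  proof -
    have "r \<in> T" using U_trees_init_seg[OF T _ that(2)] that(1) prune_subset by blast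
    then show ?thesis using that(1) init_seg_trans[OF _ that(2)] by (simp add: prune_def)
  qed
  moreover have "{n. c \<union> {n} \<in> prune T s p Y} \<in> U c" if c: "c \<in> prune T s p Y" "c \<in> front_C B" for c
  proof -
    have cT: "c \<in> T" using c(1) prune_subset by blast
    then have "finite c" using U_trees_subset[OF T] front_D_finite[OF B] by blast
    then obtain b where b: "c \<subseteq> {..<b}" using finite_nat_bounded by blast
    have "- {..<max b p} \<in> U c" using p_point_cofinite[OF pp[OF c(2)]] by blast
    then have "{n. insert n c \<in> T} \<inter> Y c \<inter> - {..<max b p} \<in> U c"
      using U_trees_succ[OF T cT c(2)] Y[OF c(2)] p_point_ultrafilter[OF pp[OF c(2)]]
      by (intro ultrafilter_Int)
    moreover have "{n. insert n c \<in> T} \<inter> Y c \<inter> - {..<max b p} \<subseteq> {n. c \<union> {n} \<in> prune T s p Y}"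
    proof
      fix n assume n: "n \<in> {n. insert n c \<in> T} \<inter> Y c \<inter> - {..<max b p}"
      then have lt: "\<forall>x\<in>c. x < n" using b by fastforce
      have "if n' < p then insert n' c' \<in> s else n' \<in> Y c'"
        if "\<forall>x\<in>c'. x < n'" "insert n' c' \<sqsubseteq> insert n c" for n' c'
        using insert_init_seg_insert_cases[OF lt that]
      proof
        assume "n' = n \<and> c' = c"
        then show ?thesis using n by simp
      next
        assume "insert n' c' \<sqsubseteq> c"
        then show ?thesis using c(1) that(1) by (simp add: prune_def)
      qed
      then show "n \<in> {n. c \<union> {n} \<in> prune T s p Y}" using n by (simp add: prune_def)
    qed
    ultimately show ?thesis by (rule ultrafilter_mono[OF p_point_ultrafilter[OF pp[OF c(2)]]])
  qed
  ultimately show ?thesis unfolding U_trees_def by blast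
qed

text \<open>A node is built by adding its elements in increasing order. Each addition stays in
  \<open>T\<close>: below \<open>p\<close> because of the stem, from \<open>p\<close> on because of
  \<open>Y\<close>.\<close>

lemma prune_succ_subset:
  assumes B: "front B" and T0: "T0 \<subseteq> front_D B" and T: "T \<in> U_trees B U"
    and Y: "\<And>c. c \<in> T \<Longrightarrow> Y c \<subseteq> {n. insert n c \<in> T}"
  shows "prune T0 (T \<inter> S) p Y \<subseteq> T"
proof
  fix a assume a: "a \<in> prune T0 (T \<inter> S) p Y"
  then have "finite a" using prune_subset T0 front_D_finite[OF B] by blast
  moreover have "\<forall>c n. (\<forall>x\<in>c. x < n) \<and> insert n c \<sqsubseteq> a \<longrightarrow>
      (if n < p then insert n c \<in> T else n \<in> Y c)"
    using a by (auto simp: prune_def split: if_splits)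
  ultimately show "a \<in> T"
  proof (induction a rule: finite_linorder_max_induct)
    case empty
    then show ?case using U_trees_empty[OF T] by blast
  next
    case (insert b A)
    have "A \<in> T"
      using insert.IH insert.prems init_seg_trans[OF _ init_seg_insert_max[OF insert.hyps(1,2)]]
      by blast
    moreover have "insert b A \<sqsubseteq> insert b A" using insert.hyps(1) by (simp add: init_seg_def)
    then have "if b < p then insert b A \<in> T else b \<in> Y A" using insert.prems insert.hyps(2) by blast
    ultimately show ?case using Y by (auto split: if_splits)
  qed
qed

section \<open>Basic maps\<close>

lemma dset_map_upt: "dset (map Q [0..<m]) = {j. j < m \<and> Q j}"
  by (auto simp: dset_def)

text \<open>A criterion of finite dependence: a finite part of \<open>X\<close> certifies
  \<open>m\<close> for all members of the family that include this part. Using inclusion rather than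
  equality also yields monotonicity.\<close>

lemma basic_mapI:
  assumes fin: "\<And>m. \<exists>k. \<forall>X\<in>\<D>. \<forall>Y\<in>\<D>. X \<inter> {..<k} \<subseteq> Y \<longrightarrow> m \<in> f X \<longrightarrow> m \<in> f Y"
  shows "basic_map f \<D>"
proof -
  obtain K where K: "\<And>m X Y. X \<in> \<D> \<Longrightarrow> Y \<in> \<D> \<Longrightarrow> X \<inter> {..<K m} \<subseteq> Y \<Longrightarrow> m \<in> f X \<Longrightarrow> m \<in> f Y"
    using fin by metis
  \<comment> \<open>The sum dominates all \<open>K j\<close> with \<open>j < m\<close>; each
    \<open>Suc\<close> makes it strictly increasing.\<close>
  define k where "k m = (\<Sum>i<m. Suc (K i))" for m
  have k: "strict_mono k" by (simp add: strict_mono_Suc_iff k_def)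
  have Kk: "K j \<le> k m" if "j < m" for j m
    using that member_le_sum[of j "{..<m}" "\<lambda>i. Suc (K i)"] by (simp add: k_def)
  have key: "j \<in> f Y" if "j < m" "X \<in> \<D>" "Y \<in> \<D>" "X \<inter> {..<k m} \<subseteq> Y" "j \<in> f X" for j m X Y
    using K[of X Y j] Kk[of j m] that by fastforce
  \<comment> \<open>Bit \<open>j\<close> asks for some member of the family extending
    \<open>s\<close> whose value contains \<open>j\<close>; by \<open>key\<close> all such members
    agree on this.\<close>
  define g where "g s = map (\<lambda>j. \<exists>X\<in>\<D>. dset s = X \<inter> {..<length s} \<and> j \<in> f X) [0..<inv k (length s)]" for s
  have inv: "inv k (k m) = m" for m
    by (rule inv_f_f) (rule strict_mono_imp_inj_on[OF k])
  have dg: "dset (g s) = {j. j < m \<and> (\<exists>X\<in>\<D>. dset s = X \<inter> {..<k m} \<and> j \<in> f X)}"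
    if "length s = k m" for s m
    unfolding g_def that inv dset_map_upt ..
  define E where "E = (\<Union>m. restr_level \<D> (k m))"
  have E: "\<exists>m X. length s = k m \<and> X \<in> \<D> \<and> dset s = X \<inter> {..<k m}" if "s \<in> E" for s
    using that by (auto simp: E_def restr_level_def)
  have len: "length (g s) = m" if "length s = k m" for s m
    using that by (simp add: g_def inv)
  have mono: "dset (g s) \<subseteq> dset (g t)"
    if st: "s \<in> E" "t \<in> E" "length s \<le> length t" "dset s \<subseteq> dset t" for s t
  proof
    fix j assume j: "j \<in> dset (g s)"
    obtain m where m: "length s = k m" using E[OF st(1)] by blast
    obtain n Y where n: "length t = k n" "Y \<in> \<D>" "dset t = Y \<inter> {..<k n}" using E[OF st(2)] by blast
    have "m \<le> n" using st(3) m n strict_mono_less_eq[OF k] by simp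
    moreover obtain X where X: "j < m" "X \<in> \<D>" "dset s = X \<inter> {..<k m}" "j \<in> f X"
      using j dg[OF m] by blast
    moreover have "j \<in> f Y" using key[of j m X Y] X n st(4) by auto
    ultimately show "j \<in> dset (g t)" using dg[OF n(1)] n by auto
  qed
  have pre: "prefix (g s) (g s')" if st: "s \<in> E" "s' \<in> E" "prefix s s'" for s s'
  proof -
    obtain m where m: "length s = k m" using E[OF st(1)] by blast
    obtain n where n: "length s' = k n" using E[OF st(2)] by blast
    have mn: "m \<le> n" using prefix_length_le[OF st(3)] m n strict_mono_less_eq[OF k] by simp
    have ds: "dset s = dset s' \<inter> {..<k m}"
      using st(3) m by (auto simp: dset_def prefix_def nth_append)
    have eq: "j \<in> dset (g s) \<longleftrightarrow> j \<in> dset (g s')" if "j < m" for j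
    proof
      show "j \<in> dset (g s')" if "j \<in> dset (g s)"
        using mono[OF st(1,2) prefix_length_le[OF st(3)]] ds that by blast
      assume "j \<in> dset (g s')"
      then obtain X where X: "X \<in> \<D>" "dset s' = X \<inter> {..<k n}" "j \<in> f X" using dg[OF n] by blast
      have "{..<k m} \<subseteq> {..<k n}" using mn strict_mono_less_eq[OF k, of m n] by simp
      then have "dset s = X \<inter> {..<k m}" unfolding ds X(2) by (metis Int_absorb1 Int_assoc)
      then show "j \<in> dset (g s)" using dg[OF m] X \<open>j < m\<close> by auto
    qed
    have "g s = take m (g s')"
    proof (rule nth_equalityI)
      show "length (g s) = length (take m (g s'))" using len[OF m] len[OF n] mn by simp
      fix j assume "j < length (g s)"
      then show "g s ! j = take m (g s') ! j"
        using eq[of j] len[OF m] len[OF n] mn by (simp add: dset_def)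
    qed
    then show ?thesis by (metis take_is_prefix)
  qed
  have val: "f X = \<Union>{dset (g s) | s m. s \<in> E \<and> length s = k m \<and> dset s = X \<inter> {..<k m}}"
    if X: "X \<in> \<D>" for X
  proof
    show "f X \<subseteq> \<Union>{dset (g s) | s m. s \<in> E \<and> length s = k m \<and> dset s = X \<inter> {..<k m}}"
    proof
      fix j assume j: "j \<in> f X"
      \<comment> \<open>Level \<open>Suc j\<close> is the first whose output has a bit at
        \<open>j\<close>.\<close>
      define s where "s = map (\<lambda>i. i \<in> X) [0..<k (Suc j)]"
      have s: "length s = k (Suc j)" "dset s = X \<inter> {..<k (Suc j)}" by (auto simp: s_def dset_map_upt)
      then have "s \<in> E" using X by (auto simp: E_def restr_level_def)
      moreover have "j \<in> dset (g s)" using dg[OF s(1)] s(2) X j by auto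
      ultimately show "j \<in> \<Union>{dset (g s) | s m. s \<in> E \<and> length s = k m \<and> dset s = X \<inter> {..<k m}}"
        using s by blast
    qed
    show "\<Union>{dset (g s) | s m. s \<in> E \<and> length s = k m \<and> dset s = X \<inter> {..<k m}} \<subseteq> f X"
    proof clarify
      fix j s m assume s: "j \<in> dset (g s)" "length s = k m" "dset s = X \<inter> {..<k m}"
      then obtain Y where "j < m" "Y \<in> \<D>" "dset s = Y \<inter> {..<k m}" "j \<in> f Y" using dg by blast
      then show "j \<in> f X" using key[of j m Y X] X s(3) by blast
    qed
  qed
  have f_mono: "monotone_on \<D> (\<supseteq>) (\<supseteq>) f"
    by (rule monotone_onI) (use K in blast)
  show ?thesis
    unfolding basic_map_def Let_def
    by (intro conjI exI[of _ k] exI[of _ g], unfold E_def[symmetric])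
      (intro f_mono k ballI allI impI mono pre val len; (elim conjE)?; assumption)+
qed

section \<open>Values of \<open>f\<close> decided by finite parts of trees\<close>

theorem theorem13:
  fixes B :: "nat set set" and U :: "nat set \<Rightarrow> nat set set"
    and V :: "nat set set" and f :: "nat set set \<Rightarrow> nat set"
  assumes "front B"
    and "\<forall>c \<in> front_C B. p_point (U c)"
    and "ultrafilter V"
    and "f ` U_trees B U \<subseteq> V"
    and "monotone_on (U_trees B U) (\<supseteq>) (\<supseteq>) f"
    and "cofinal_map f (U_trees B U) V"
  shows "\<exists>T' \<in> U_trees B U. basic_on (front_D B) f {T \<in> U_trees B U. T \<subseteq> T'}"
proof -
  note B = assms(1)
  have pp: "p_point (U c)" if "c \<in> front_C B" for c using assms(2) that by blast
  note uf = p_point_ultrafilter[OF pp]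
  have f_mono: "f T \<subseteq> f T'" if "T \<in> U_trees B U" "T' \<in> U_trees B U" "T \<subseteq> T'" for T T'
    using assms(5) that by (auto simp: monotone_on_def)
  \<comment> \<open>Without trees the empty family would be cofinal, yet its empty image is not
    cofinal in \<open>V\<close>.\<close>
  have "U_trees B U \<noteq> {}"
  proof
    assume "U_trees B U = {}"
    then have "cofinal_in (f ` {}) V"
      using assms(6) by (auto simp: cofinal_map_def cofinal_in_def)
    then show False using ultrafilter_UNIV[OF assms(3)] by (auto simp: cofinal_in_def)
  qed
  then obtain T0 where T0: "T0 \<in> U_trees B U" by blast
  note prune_tree = prune_U_tree[OF B pp T0]
  define sys where "sys Y \<longleftrightarrow> (\<forall>c\<in>front_C B. Y c \<in> U c)" for Y
  define forced where "forced p s m \<longleftrightarrow> (\<forall>Y. sys Y \<longrightarrow> m \<in> f (prune T0 s p Y))" for p s m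
  have tree: "prune T0 s p Y \<in> U_trees B U" if "sys Y" for s p Y
    using that prune_tree by (simp add: sys_def)
  \<comment> \<open>If \<open>m\<close> is not forced, \<open>W p s m\<close> is a system witnessing
    this; otherwise any system will do.\<close>
  define W where "W p s m = (SOME Y. sys Y \<and> (m \<in> f (prune T0 s p Y) \<longrightarrow> forced p s m))" for p s m
  have W_ex: "\<exists>Y. sys Y \<and> (m \<in> f (prune T0 s p Y) \<longrightarrow> forced p s m)" for p s m
  proof (cases "forced p s m")
    case True
    moreover have "sys (\<lambda>_. UNIV)" using ultrafilter_UNIV uf by (auto simp: sys_def)
    ultimately show ?thesis by blast
  qed (auto simp: forced_def)
  have W: "sys (W p s m)" "m \<in> f (prune T0 s p (W p s m)) \<Longrightarrow> forced p s m" for p s m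
    using someI_ex[OF W_ex[of m s p]] unfolding W_def by blast+
  \<comment> \<open>Only finitely many pairs of a stem \<open>s\<close> and a number
    \<open>m\<close> occur at level \<open>p\<close>, so the intersection stays in the
    ultrafilter.\<close>
  define Y where "Y p c = (\<Inter>(s, m)\<in>Pow (Pow {..<p}) \<times> {..p}. W p s m c)" for p :: nat and c
  have Y_sys: "sys (Y p)" for p
    unfolding sys_def Y_def using W(1) by (auto intro!: ultrafilter_INT uf simp: sys_def)
  have Y_decides: "forced p s m" if "s \<subseteq> Pow {..<p}" "m \<le> p" "m \<in> f (prune T0 s p (Y p))" for p s m
  proof -
    have "Y p c \<subseteq> W p s m c" for c using that(1,2) by (auto simp: Y_def)
    then have "prune T0 s p (Y p) \<subseteq> prune T0 s p (W p s m)"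
      unfolding prune_def by (auto split: if_splits)
    then show ?thesis using f_mono[OF tree tree] Y_sys W that(3) by blast
  qed
  have "\<exists>X I. infinite I \<and> (\<forall>c\<in>front_C B. X c \<in> U c \<and> (\<forall>p\<in>I. \<forall>n\<in>X c. p \<le> n \<longrightarrow> n \<in> Y p c))"
    using Y_sys by (intro p_points_fusion countable_front_C pp) (simp_all add: sys_def)
  then obtain X I where I: "infinite I" and
    XI: "\<forall>c\<in>front_C B. X c \<in> U c \<and> (\<forall>p\<in>I. \<forall>n\<in>X c. p \<le> n \<longrightarrow> n \<in> Y p c)" by blast
  have X: "X c \<in> U c" if "c \<in> front_C B" for c using XI that by blast
  have XY: "n \<in> Y p c" if "c \<in> front_C B" "p \<in> I" "n \<in> X c" "p \<le> n" for c p n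
    using XI that by blast
  \<comment> \<open>With level 0 the stem imposes nothing, and every step must obey
    \<open>X\<close>.\<close>
  define T' where "T' = prune T0 {} 0 X"
  have T': "T' \<in> U_trees B U" unfolding T'_def by (rule tree) (simp add: sys_def X)
  \<comment> \<open>Steps of \<open>T\<close> from \<open>p\<close> on obey \<open>X\<close>, hence
    \<open>Y p\<close> because \<open>p\<close> is in \<open>I\<close>; its nodes inside
    \<open>{..<p}\<close> form the stem.\<close>
  have below: "T \<subseteq> prune T0 (T \<inter> Pow {..<p}) p (Y p)"
    if T: "T \<in> U_trees B U" "T \<subseteq> T'" and p: "p \<in> I" for T p
  proof
    fix a assume a: "a \<in> T"
    then have aT: "a \<in> T0" "a \<in> T'" using T(2) prune_subset unfolding T'_def by blast+
    have "if n < p then insert n c \<in> T \<inter> Pow {..<p} else n \<in> Y p c"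
      if c: "\<forall>x\<in>c. x < n" "insert n c \<sqsubseteq> a" for c n
    proof -
      have nc: "insert n c \<in> T" using U_trees_init_seg[OF T(1) a c(2)] .
      have "finite c" using c(2) by (simp add: init_seg_def)
      then have "c \<in> front_C B"
        using front_C_if_proper_init_seg[OF B _ init_seg_insert_max[OF _ c(1)]] nc
          U_trees_subset[OF T(1)] c(1) by blast
      moreover have "n \<in> X c" using aT(2) c by (simp add: T'_def prune_def)
      ultimately show ?thesis using nc XY[of c p n] p c(1) by force
    qed
    then show "a \<in> prune T0 (T \<inter> Pow {..<p}) p (Y p)" using aT(1) unfolding prune_def by blast
  qed
  have above: "m \<in> f T" if T: "T \<in> U_trees B U" and m: "forced p (T \<inter> Pow {..<p}) m" for T p m
  proof -
    \<comment> \<open>The successor sets of \<open>T\<close> itself serve as a test system;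
      \<open>UNIV\<close> is a harmless value off \<open>T\<close>.\<close>
    define Z where "Z c = (if c \<in> T then {n. insert n c \<in> T} else UNIV)" for c
    have Z: "sys Z" using U_trees_succ[OF T] ultrafilter_UNIV uf by (auto simp: sys_def Z_def)
    have "prune T0 (T \<inter> Pow {..<p}) p Z \<subseteq> T"
      by (rule prune_succ_subset[OF B U_trees_subset[OF T0] T]) (simp add: Z_def)
    then show ?thesis using f_mono[OF tree[OF Z] T] m Z unfolding forced_def by blast
  qed
  \<comment> \<open>By \<open>below\<close> and \<open>Y_decides\<close>, membership in
    \<open>f T\<close> makes \<open>m\<close> forced by the stem of \<open>T\<close>. Enlarging the
    stem to that of \<open>R\<close> enlarges the pruned trees, so \<open>m\<close> stays forced,
    and \<open>above\<close> applies.\<close>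
  have local: "m \<in> f R"
    if "T \<in> U_trees B U" "T \<subseteq> T'" "R \<in> U_trees B U" "p \<in> I" "m \<le> p"
      "T \<inter> Pow {..<p} \<subseteq> R" "m \<in> f T" for T R p m
  proof -
    have "m \<in> f (prune T0 (T \<inter> Pow {..<p}) p (Y p))"
      using f_mono[OF _ tree[OF Y_sys] below] that by blast
    then have "forced p (T \<inter> Pow {..<p}) m" by (intro Y_decides that(5)) auto
    moreover have "T \<inter> Pow {..<p} \<subseteq> R \<inter> Pow {..<p}" using that(6) by blast
    then have "prune T0 (T \<inter> Pow {..<p}) p Z \<subseteq> prune T0 (R \<inter> Pow {..<p}) p Z" for Z
      by (rule prune_mono)
    ultimately have "forced p (R \<inter> Pow {..<p}) m"
      unfolding forced_def using f_mono[OF tree tree] by blast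
    then show ?thesis by (rule above[OF that(3)])
  qed
  define d where "d = prec_enum (front_D B)"
  have d: "range d = front_D B" using prec_enum_front(1)[OF B] by (simp add: d_def bij_betw_def)
  have d_vimage: "d ` (d -` T) = T" if "T \<in> U_trees B U" for T
    using U_trees_subset[OF that] d by auto
  have "basic_map (\<lambda>X. f (d ` X)) ((\<lambda>T. d -` T) ` {T \<in> U_trees B U. T \<subseteq> T'})"
  proof (rule basic_mapI)
    fix m
    obtain p where p: "p \<in> I" "m \<le> p" using I infinite_nat_iff_unbounded_le by blast
    \<comment> \<open>The finitely many nodes inside \<open>{..<p}\<close> have bounded indices,
      which turns the level \<open>p\<close> into a level \<open>k\<close> of the
      enumeration.\<close>
    have "finite (Pow {..<p} \<inter> front_D B)" by simp
    then obtain F where F: "finite F" "Pow {..<p} \<inter> front_D B = d ` F"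
      using finite_subset_image[of "Pow {..<p} \<inter> front_D B" d UNIV] d by auto
    obtain k where k: "F \<subseteq> {..<k}" using finite_nat_bounded[OF F(1)] by blast
    have "m \<in> f R" if T: "T \<in> U_trees B U" "T \<subseteq> T'" "R \<in> U_trees B U"
      "d -` T \<inter> {..<k} \<subseteq> d -` R" "m \<in> f T" for T R
    proof -
      have "T \<inter> Pow {..<p} \<subseteq> R"
      proof
        fix a assume a: "a \<in> T \<inter> Pow {..<p}"
        then have "a \<in> d ` F" using F(2) U_trees_subset[OF T(1)] by blast
        then show "a \<in> R" using a k T(4) by blast
      qed
      then show ?thesis using local[of T R p m] T p by blast
    qed
    then show "\<exists>k. \<forall>X\<in>(\<lambda>T. d -` T) ` {T \<in> U_trees B U. T \<subseteq> T'}.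
        \<forall>Y\<in>(\<lambda>T. d -` T) ` {T \<in> U_trees B U. T \<subseteq> T'}.
        X \<inter> {..<k} \<subseteq> Y \<longrightarrow> m \<in> f (d ` X) \<longrightarrow> m \<in> f (d ` Y)"
      using d_vimage by (intro exI[of _ k]) auto
  qed
  then show ?thesis using T' unfolding basic_on_def d_def by blast
qed

end
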